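(* Let $E$ and $F$ be Banach lattices. If every positive disjointly weakly compact operator from $E$ into $F$ is weakly precompact, then at least one of the following assertions is valid: (1) The norm of $E'$ is order continuous. (2) Every order interval in $F$ is weakly precompact.
   Context: Banach lattices are real; $E'$ is the norm dual of $E$, $B_E$ the closed unit ball. A sequence $(x_n)$ in a Banach lattice is disjoint if $|x_n|\wedge|x_m|=0$ for $n\neq m$. $Sol(A)=\{x: |x|\le |a| \text{ for some } a\in A\}$ is the solid hull of $A$. A norm bounded set $A$ in a Banach lattice is disjointly weakly compact if every disjoint sequence in $Sol(A)$ converges weakly to zero. A bounded linear operator $T$ from a Banach space $X$ to a Banach lattice is disjointly weakly compact if $T(B_X)$ is a disjointly weakly compact set. A bounded set $A$ in a Banach space is weakly precompact if every sequence in $A$ has a weakly Cauchy subsequence; an operator between Banach spaces is weakly precompact if it maps norm bounded sets to weakly precompact sets. *)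

theory Defs
  imports "HOL-Analysis.Analysis" "HOL-Library.Lattice_Algebras"
begin

class banach_lattice = banach + ordered_real_vector + lattice_ab_group_add_abs +
  assumes norm_mono_abs: "\<bar>x\<bar> \<le> \<bar>y\<bar> \<Longrightarrow> norm x \<le> norm y"

instance real :: banach_lattice
  by standard simp

(* The usual order on bounded operators: 0 \<le> T says that T is positive.  On
   'a \<Rightarrow>\<^sub>L real it is the order of the dual Banach lattice. *)
instantiation blinfun :: (banach_lattice, banach_lattice) order
begin

definition less_eq_blinfun :: "('a \<Rightarrow>\<^sub>L 'b) \<Rightarrow> ('a \<Rightarrow>\<^sub>L 'b) \<Rightarrow> bool" where
  "less_eq_blinfun S T \<longleftrightarrow> (\<forall>x\<ge>0. blinfun_apply S x \<le> blinfun_apply T x)"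

definition less_blinfun :: "('a \<Rightarrow>\<^sub>L 'b) \<Rightarrow> ('a \<Rightarrow>\<^sub>L 'b) \<Rightarrow> bool" where
  "less_blinfun S T \<longleftrightarrow> S \<le> T \<and> \<not> T \<le> S"

instance
proof
  fix S T U :: "'a \<Rightarrow>\<^sub>L 'b"
  show "S < T \<longleftrightarrow> S \<le> T \<and> \<not> T \<le> S"
    by (rule less_blinfun_def)
  show "S \<le> S"
    by (simp add: less_eq_blinfun_def)
  show "S \<le> T \<Longrightarrow> T \<le> U \<Longrightarrow> S \<le> U"
    unfolding less_eq_blinfun_def using order_trans by blast
  assume le: "S \<le> T" "T \<le> S"
  have pos: "blinfun_apply S x = blinfun_apply T x" if "0 \<le> x" for x
    using le that by (simp add: less_eq_blinfun_def order.antisym)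
  show "S = T"
  proof (rule blinfun_eqI)
    fix x :: 'a
    have x: "x = pprt x - pprt (- x)"
      by (metis prts diff_minus_eq_add pprt_neg)
    have "blinfun_apply S (pprt x - pprt (- x)) = blinfun_apply T (pprt x - pprt (- x))"
      by (simp add: blinfun.diff_right pos)
    then show "blinfun_apply S x = blinfun_apply T x"
      using x by simp
  qed
qed

end

definition weakly_convergent_to :: "(nat \<Rightarrow> 'a::real_normed_vector) \<Rightarrow> 'a \<Rightarrow> bool" where
  "weakly_convergent_to x l \<longleftrightarrow>
     (\<forall>f :: 'a \<Rightarrow>\<^sub>L real. (\<lambda>n. blinfun_apply f (x n)) \<longlonglongrightarrow> blinfun_apply f l)"

definition weakly_Cauchy :: "(nat \<Rightarrow> 'a::real_normed_vector) \<Rightarrow> bool" where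
  "weakly_Cauchy x \<longleftrightarrow> (\<forall>f :: 'a \<Rightarrow>\<^sub>L real. Cauchy (\<lambda>n. blinfun_apply f (x n)))"

definition weakly_precompact :: "'a::real_normed_vector set \<Rightarrow> bool" where
  "weakly_precompact A \<longleftrightarrow> bounded A \<and>
     (\<forall>x :: nat \<Rightarrow> 'a. range x \<subseteq> A \<longrightarrow> (\<exists>r. strict_mono r \<and> weakly_Cauchy (x \<circ> r)))"

definition weakly_precompact_operator ::
    "('a::real_normed_vector \<Rightarrow>\<^sub>L 'b::real_normed_vector) \<Rightarrow> bool" where
  "weakly_precompact_operator T \<longleftrightarrow>
     (\<forall>A. bounded A \<longrightarrow> weakly_precompact (blinfun_apply T ` A))"

definition disjoint_sequence :: "(nat \<Rightarrow> 'a::banach_lattice) \<Rightarrow> bool" where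
  "disjoint_sequence x \<longleftrightarrow> (\<forall>n m. n \<noteq> m \<longrightarrow> inf \<bar>x n\<bar> \<bar>x m\<bar> = 0)"

definition solid_hull :: "'a::banach_lattice set \<Rightarrow> 'a set" where
  "solid_hull A = {x. \<exists>a\<in>A. \<bar>x\<bar> \<le> \<bar>a\<bar>}"

definition disjointly_weakly_compact :: "'a::banach_lattice set \<Rightarrow> bool" where
  "disjointly_weakly_compact A \<longleftrightarrow> bounded A \<and>
     (\<forall>x. range x \<subseteq> solid_hull A \<and> disjoint_sequence x \<longrightarrow> weakly_convergent_to x 0)"

definition disjointly_weakly_compact_operator ::
    "('a::real_normed_vector \<Rightarrow>\<^sub>L 'b::banach_lattice) \<Rightarrow> bool" where
  "disjointly_weakly_compact_operator T \<longleftrightarrow>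
     disjointly_weakly_compact (blinfun_apply T ` cball 0 1)"

(* Every net decreasing to 0 converges to 0 in norm.  A decreasing net is represented by
   its range, a downward directed set D indexed by itself; the conclusion is norm
   convergence of that net.  Only the order and the norm of the space enter, so that the
   notion applies to the dual 'a \<Rightarrow>\<^sub>L real without making its lattice operations explicit. *)
definition order_continuous_norm :: "'a::{order, real_normed_vector} itself \<Rightarrow> bool" where
  "order_continuous_norm (_ :: 'a itself) \<longleftrightarrow>
     (\<forall>D :: 'a set.
        D \<noteq> {} \<and> (\<forall>x\<in>D. \<forall>y\<in>D. \<exists>z\<in>D. z \<le> x \<and> z \<le> y) \<and>
        (\<forall>x\<in>D. 0 \<le> x) \<and> (\<forall>l. (\<forall>x\<in>D. l \<le> x) \<longrightarrow> l \<le> 0) \<longrightarrow>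
        (\<forall>e>0. \<exists>d\<in>D. \<forall>x\<in>D. x \<le> d \<longrightarrow> norm x < e))"

end

(* If the norm of E' is not order continuous, some downward directed D in E'_+ has infimum 0
   while its norms stay above r > 0.  Descending along D and disjointifying almost-norming
   vectors, one finds positive functionals psi_n with sum psi_n \<le> d0 and bounded vectors v_n
   such that psi_n(v_m) = 0 for n \<noteq> m and psi_n(v_n) \<ge> r/4.  If moreover (y_n) in an order
   interval [0, b] of F has no weakly Cauchy subsequence, then T x = sum psi_n(x) y_n is positive
   and maps the ball into an order interval, so it is disjointly weakly compact: a signed sum of
   order bounded disjoint elements is bounded independently of its length.  But T maps
   v_n / psi_n(v_n) to y_n. *)

theory Submission
  imports Defs
begin

section \<open>Banach lattices\<close>

lemma inf_scaleR:
  fixes x y :: "'a::banach_lattice"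
  assumes "0 < c"
  shows "inf (c *\<^sub>R x) (c *\<^sub>R y) = c *\<^sub>R inf x y"
proof (rule antisym)
  show "inf (c *\<^sub>R x) (c *\<^sub>R y) \<le> c *\<^sub>R inf x y"
    using pos_divideR_le_eq[OF assms, of "inf (c *\<^sub>R x) (c *\<^sub>R y)"] by (metis inf.cobounded1 inf.cobounded2 le_inf_iff)
  show "c *\<^sub>R inf x y \<le> inf (c *\<^sub>R x) (c *\<^sub>R y)"
    using assms by (simp add: scaleR_left_mono)
qed

text \<open>Distributing + over inf turns the right side into the infimum of a + a, a + c, b + a and
  b + c. The first three dominate a, the last is b + c.\<close>

lemma inf_add_le:
  fixes a b c :: "'a::banach_lattice"
  assumes "0 \<le> a" "0 \<le> b" "0 \<le> c"
  shows "inf a (b + c) \<le> inf a b + inf a c"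
proof -
  have "a \<le> a + a" "a \<le> b + a" "a \<le> a + c" using assms by simp_all
  then show ?thesis
    by (auto simp: add_inf_distrib_left add_inf_distrib_right intro: le_infI1)
qed

lemma inf_add_eq_0:
  fixes a b c :: "'a::banach_lattice"
  assumes "0 \<le> a" "0 \<le> b" "0 \<le> c" "inf a b = 0" "inf a c = 0"
  shows "inf a (b + c) = 0"
  using inf_add_le[OF assms(1-3)] assms by (intro antisym) auto

text \<open>With s = max 1 t, both \<open>a\<close> and \<open>t *\<^sub>R b\<close> lie below the
  s-multiples of \<open>a\<close> and \<open>b\<close>, and those are disjoint by
  homogeneity.\<close>

lemma inf_scaleR_eq_0:
  fixes a b :: "'a::banach_lattice"
  assumes "inf a b = 0" "0 \<le> t"
  shows "inf a (t *\<^sub>R b) = 0"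
proof (rule antisym)
  have ab: "0 \<le> a" "0 \<le> b" using assms(1) by (metis inf.cobounded1, metis inf.cobounded2)
  define s where "s = max 1 t"
  have "1 *\<^sub>R a \<le> s *\<^sub>R a" "t *\<^sub>R b \<le> s *\<^sub>R b"
    using ab by (auto simp only: s_def intro!: scaleR_right_mono)
  then have "inf a (t *\<^sub>R b) \<le> inf (s *\<^sub>R a) (s *\<^sub>R b)" by (intro inf_mono) auto
  also have "\<dots> = 0" using assms by (subst inf_scaleR) (auto simp: s_def)
  finally show "inf a (t *\<^sub>R b) \<le> 0" .
  show "0 \<le> inf a (t *\<^sub>R b)" using ab assms by (simp add: scaleR_nonneg_nonneg)
qed

text \<open>A sum of disjoint positive elements is their supremum, because x + y = inf x y + sup x
  y. Hence the bound does not grow with the number of terms.\<close>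

lemma disjoint_sum_le:
  fixes x :: "nat \<Rightarrow> 'a::banach_lattice"
  assumes "\<And>n. 0 \<le> x n" "\<And>n m. n \<noteq> m \<Longrightarrow> inf (x n) (x m) = 0" "\<And>n. x n \<le> y"
  shows "(\<Sum>n<N. x n) \<le> y"
proof (induction N)
  case 0
  have "0 \<le> y" using assms(1,3) by (rule order_trans)
  then show ?case by simp
next
  case (Suc N)
  \<comment> \<open>The restriction to M \<le> N keeps every index in the sum different from
    N.\<close>
  have "M \<le> N \<Longrightarrow> inf (x N) (\<Sum>n<M. x n) = 0" for M
  proof (induction M)
    case 0
    then show ?case using assms(1) by (simp add: inf.absorb2)
  next
    case (Suc M)
    then show ?case by (simp, intro inf_add_eq_0) (use assms in \<open>auto intro!: sum_nonneg\<close>)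
  qed
  then have "inf (x N) (\<Sum>n<N. x n) = 0" by simp
  then have "(\<Sum>n<Suc N. x n) = sup (x N) (\<Sum>n<N. x n)"
    using add_eq_inf_sup[of "x N" "\<Sum>n<N. x n"] by (simp add: add.commute)
  then show ?case using Suc assms(3) by simp
qed

section \<open>Norm, order and limits\<close>

lemma norm_mono:
  fixes x y :: "'a::banach_lattice"
  assumes "0 \<le> x" "x \<le> y"
  shows "norm x \<le> norm y"
  using assms order_trans[OF assms] by (intro norm_mono_abs) simp

lemma norm_abs [simp]: "norm \<bar>x\<bar> = norm (x::'a::banach_lattice)"
  by (intro antisym norm_mono_abs) auto

lemma pprt_diff_pprt_uminus: "pprt x - pprt (- x) = (x::'a::banach_lattice)"
  using prts[of x] by (simp add: pprt_neg)

lemma pprt_le_abs: "pprt x \<le> \<bar>x::'a::banach_lattice\<bar>"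
  by (simp add: pprt_def abs_ge_self)

lemma norm_pprt_le: "norm (pprt x) \<le> norm (x::'a::banach_lattice)"
  using norm_mono[OF _ pprt_le_abs, of x] by simp

text \<open>The modulus is nonexpansive. A positive sequence equals its own moduli, so it also
  converges to the modulus of its limit.\<close>

lemma closed_nonneg: "closed {x::'a::banach_lattice. 0 \<le> x}"
unfolding closed_sequential_limits
proof (intro allI impI, elim conjE)
  fix x :: "nat \<Rightarrow> 'a" and l
  assume x: "\<forall>n. x n \<in> {x. 0 \<le> x}" and l: "x \<longlonglongrightarrow> l"
  have "norm (x n - \<bar>l\<bar>) \<le> norm (x n - l)" for n
    using x abs_triangle_ineq3[of "x n" l] by (intro norm_mono_abs) auto
  then have "(\<lambda>n. x n - \<bar>l\<bar>) \<longlonglongrightarrow> 0"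
    by (intro Lim_null_comparison[OF _ tendsto_norm_zero[OF LIM_zero[OF l]]] always_eventually allI)
  then have "l = \<bar>l\<bar>" using LIM_zero_cancel LIMSEQ_unique[OF l] by blast
  then show "l \<in> {x. 0 \<le> x}" by (metis abs_ge_zero mem_Collect_eq)
qed

lemma lim_mono_lattice:
  fixes x :: "nat \<Rightarrow> 'a::banach_lattice"
  assumes "x \<longlonglongrightarrow> l" "eventually (\<lambda>n. a \<le> x n) sequentially"
  shows "a \<le> l"
proof -
  have "l - a \<in> {x. 0 \<le> x}"
    by (rule Lim_in_closed_set[OF closed_nonneg _ _ tendsto_diff[OF assms(1) tendsto_const]])
      (use assms(2) in auto)
  then show ?thesis by simp
qed

lemma bounded_Icc_lattice: "bounded {a..b::'a::banach_lattice}"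
proof -
  have "norm x \<le> norm (\<bar>a\<bar> + \<bar>b\<bar>)" if "a \<le> x" "x \<le> b" for x
  proof (rule norm_mono_abs)
    have "x \<le> \<bar>b\<bar>" "- x \<le> \<bar>a\<bar>"
      using that(2) abs_ge_self[of b] neg_le_iff_le[THEN iffD2, OF that(1)] abs_ge_minus_self[of a]
      by (blast intro: order_trans)+
    then have "\<bar>x\<bar> \<le> \<bar>a\<bar> + \<bar>b\<bar>"
      by (intro abs_leI) (auto intro: add_increasing add_increasing2)
    then show "\<bar>x\<bar> \<le> \<bar>\<bar>a\<bar> + \<bar>b\<bar>\<bar>" by (meson abs_ge_self order_trans)
  qed
  then show ?thesis by (intro boundedI) auto
qed

lemma functional_le_norm: "blinfun_apply f x \<le> norm f * norm x" for f :: "'a::real_normed_vector \<Rightarrow>\<^sub>L real"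
  using norm_blinfun[of f x] by simp

text \<open>Every functional is absolutely summable along the sequence: by disjointness all signed
  partial sums have modulus at most \<open>y\<close>.\<close>

lemma order_bounded_disjoint_weakly_null:
  fixes x :: "nat \<Rightarrow> 'a::banach_lattice"
  assumes dis: "disjoint_sequence x" and le: "\<And>n. \<bar>x n\<bar> \<le> y"
  shows "weakly_convergent_to x 0"
  unfolding weakly_convergent_to_def
proof
  fix f :: "'a \<Rightarrow>\<^sub>L real"
  have "(\<Sum>n<N. \<bar>f (x n)\<bar>) \<le> norm f * norm y" for N
  proof -
    \<comment> \<open>The signs make each f (z n) equal to the absolute value of f (x n), so one
      application of \<open>f\<close> to the sum captures all terms.\<close>
    define z where "z n = (if 0 \<le> f (x n) then x n else - x n)" for n
    have "\<bar>\<Sum>n<N. z n\<bar> \<le> (\<Sum>n<N. \<bar>z n\<bar>)" by simp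
    also have "\<dots> = (\<Sum>n<N. \<bar>x n\<bar>)" by (intro sum.cong) (auto simp: z_def)
    also have "\<dots> \<le> y" using dis le by (intro disjoint_sum_le) (auto simp: disjoint_sequence_def)
    finally have z: "norm (\<Sum>n<N. z n) \<le> norm y"
      using norm_mono[of "\<bar>\<Sum>n<N. z n\<bar>"] by simp
    have "(\<Sum>n<N. \<bar>f (x n)\<bar>) = f (\<Sum>n<N. z n)"
      by (auto simp: z_def blinfun.sum_right blinfun.minus_right intro!: sum.cong)
    also have "\<dots> \<le> norm f * norm (\<Sum>n<N. z n)" by (rule functional_le_norm)
    also have "\<dots> \<le> norm f * norm y" using z by (simp add: mult_left_mono)
    finally show ?thesis .
  qed
  then have "summable (\<lambda>n. \<bar>f (x n)\<bar>)" by (intro bounded_imp_summable[where B = "norm f * norm y"])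
    (auto simp: lessThan_Suc_atMost[symmetric] simp del: sum.lessThan_Suc)
  then show "(\<lambda>n. f (x n)) \<longlonglongrightarrow> f 0"
    using summable_LIMSEQ_zero tendsto_rabs_zero_iff by (fastforce simp: blinfun.zero_right)
qed

section \<open>Positive functionals\<close>

lemma positive_functional_mono:
  fixes f :: "'a::banach_lattice \<Rightarrow>\<^sub>L real"
  assumes "0 \<le> f" "x \<le> y"
  shows "f x \<le> f y"
  using assms[unfolded less_eq_blinfun_def] by (metis blinfun.diff_right blinfun.zero_left diff_ge_0_iff_ge)

lemma positive_functional_nonneg:
  fixes f :: "'a::banach_lattice \<Rightarrow>\<^sub>L real"
  assumes "0 \<le> f" "0 \<le> x"
  shows "0 \<le> f x"
  using positive_functional_mono[OF assms] by (simp add: blinfun.zero_right)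

lemma positive_functional_abs_le:
  fixes f :: "'a::banach_lattice \<Rightarrow>\<^sub>L real"
  assumes "0 \<le> f"
  shows "\<bar>f x\<bar> \<le> f \<bar>x\<bar>"
  using positive_functional_mono[OF assms, of x "\<bar>x\<bar>"] positive_functional_mono[OF assms, of "- x" "\<bar>x\<bar>"]
    abs_ge_self[of x] abs_ge_minus_self[of x]
  by (simp add: blinfun.minus_right abs_le_iff)

text \<open>Passing from x to its modulus does not decrease the value of a positive functional and
  keeps the norm, so almost-norming vectors may be taken positive.\<close>

lemma positive_functional_norm_attain:
  fixes f :: "'a::banach_lattice \<Rightarrow>\<^sub>L real"
  assumes "0 \<le> f" "r < norm f" "0 \<le> r"
  obtains u where "0 \<le> u" "norm u \<le> 1" "r < f u"
proof -
  obtain x where x: "r * norm x < \<bar>f x\<bar>"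
    using norm_blinfun_bound[of r f] assms(2,3) by (auto simp flip: not_le)
  then have "x \<noteq> 0" by (auto simp: blinfun.zero_right)
  define u where "u = (1 / norm x) *\<^sub>R \<bar>x\<bar>"
  have "r * norm x < f \<bar>x\<bar>" using x positive_functional_abs_le[OF assms(1), of x] by simp
  then have "r < f u" using \<open>x \<noteq> 0\<close> by (simp add: u_def blinfun.scaleR_right field_simps)
  moreover have "0 \<le> u" by (simp add: u_def scaleR_nonneg_nonneg)
  moreover have "norm u \<le> 1" by (simp add: u_def)
  ultimately show ?thesis using that by blast
qed

text \<open>Kantorovich's extension: an additive map on the positive cone extends linearly through x
  = pprt x - pprt (- x). Positivity and the bound on the cone make the extension continuous.\<close>

lemma positive_cone_extension:
  fixes p :: "'a::banach_lattice \<Rightarrow> real"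
  assumes nonneg: "\<And>x. 0 \<le> x \<Longrightarrow> 0 \<le> p x"
    and add: "\<And>x y. 0 \<le> x \<Longrightarrow> 0 \<le> y \<Longrightarrow> p (x + y) = p x + p y"
    and scale_le: "\<And>c x. 0 < c \<Longrightarrow> 0 \<le> x \<Longrightarrow> p (c *\<^sub>R x) \<le> c * p x"
    and bound: "\<And>x. 0 \<le> x \<Longrightarrow> p x \<le> K * norm x"
  obtains f :: "'a \<Rightarrow>\<^sub>L real" where "\<And>x. 0 \<le> x \<Longrightarrow> f x = p x"
proof -
  have p0: "p 0 = 0" using add[of 0 0] by simp
  have scale: "p (c *\<^sub>R x) = c * p x" if "0 \<le> c" "0 \<le> x" for c x
  proof (cases "c = 0")
    case False
    then have "0 < c" using that by simp
    \<comment> \<open>Applying \<open>scale_le\<close> to 1/c and c x gives the reverse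
      inequality.\<close>
    then have "p ((1 / c) *\<^sub>R (c *\<^sub>R x)) \<le> (1 / c) * p (c *\<^sub>R x)"
      using that by (intro scale_le) (auto simp: scaleR_nonneg_nonneg)
    then have "c * p x \<le> p (c *\<^sub>R x)" using \<open>0 < c\<close> by (simp add: field_simps)
    then show ?thesis using scale_le[OF \<open>0 < c\<close> that(2)] by simp
  qed (simp add: p0)
  define g where "g x = p (pprt x) - p (pprt (- x))" for x
  \<comment> \<open>The value does not depend on how x is written as a difference of positive
    elements. Linearity of \<open>g\<close> rests on this.\<close>
  have g: "g (a - b) = p a - p b" if "0 \<le> a" "0 \<le> b" for a b
  proof -
    let ?x = "a - b"
    have "pprt ?x + b = a + pprt (- ?x)"
      using pprt_diff_pprt_uminus[of ?x] by (simp add: algebra_simps)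
    then have "p (pprt ?x) + p b = p a + p (pprt (- ?x))"
      using that by (metis add zero_le_pprt)
    then show ?thesis by (simp add: g_def)
  qed
  have "bounded_linear g"
  proof (rule bounded_linear_intro)
    fix x y :: 'a and r :: real
    have "x + y = (pprt x + pprt y) - (pprt (- x) + pprt (- y))"
      using pprt_diff_pprt_uminus[of x] pprt_diff_pprt_uminus[of y] by (simp add: algebra_simps)
    then show "g (x + y) = g x + g y"
      using g[of "pprt x + pprt y" "pprt (- x) + pprt (- y)"] by (simp add: add g_def)
    have rx: "r *\<^sub>R x = r *\<^sub>R pprt x - r *\<^sub>R pprt (- x)"
      by (metis pprt_diff_pprt_uminus scaleR_diff_right)
    show "g (r *\<^sub>R x) = r *\<^sub>R g x"
    proof (cases "0 \<le> r")
      case True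
      have "g (r *\<^sub>R x) = p (r *\<^sub>R pprt x) - p (r *\<^sub>R pprt (- x))"
        unfolding rx by (intro g scaleR_nonneg_nonneg True zero_le_pprt)
      then show ?thesis using True by (simp add: scale g_def algebra_simps)
    next
      case False
      then have r: "0 \<le> - r" by simp
      have "r *\<^sub>R x = (- r) *\<^sub>R pprt (- x) - (- r) *\<^sub>R pprt x" using rx by simp
      then have "g (r *\<^sub>R x) = p ((- r) *\<^sub>R pprt (- x)) - p ((- r) *\<^sub>R pprt x)"
        by (simp only:) (intro g scaleR_nonneg_nonneg r zero_le_pprt)
      also have "\<dots> = (- r) * p (pprt (- x)) - (- r) * p (pprt x)"
        by (simp only: scale[OF r] zero_le_pprt)
      finally show ?thesis by (simp add: g_def algebra_simps)
    qed
    have "p (pprt z) \<le> \<bar>K\<bar> * norm z" for z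
    proof -
      have "p (pprt z) \<le> K * norm (pprt z)" by (simp add: bound)
      also have "\<dots> \<le> \<bar>K\<bar> * norm z" by (intro mult_mono norm_pprt_le) auto
      finally show ?thesis .
    qed
    from this[of x] this[of "- x"] show "norm (g x) \<le> norm x * (2 * \<bar>K\<bar>)"
      using nonneg[of "pprt x"] nonneg[of "pprt (- x)"] by (simp add: g_def abs_le_iff mult.commute[of "norm x"])
  qed
  then show ?thesis
    using that[of "Blinfun g"] g[of _ 0] p0 by (auto simp: bounded_linear_Blinfun_apply)
qed

text \<open>The conditions that \<open>order_continuous_norm\<close> puts on a net, apart from
  nonemptiness.\<close>

definition decreases_to_zero :: "('a::banach_lattice \<Rightarrow>\<^sub>L real) set \<Rightarrow> bool" where
  "decreases_to_zero D \<longleftrightarrow> (\<forall>f\<in>D. \<forall>g\<in>D. \<exists>h\<in>D. h \<le> f \<and> h \<le> g) \<and> (\<forall>f\<in>D. 0 \<le> f) \<and>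
    (\<forall>l. (\<forall>f\<in>D. l \<le> f) \<longrightarrow> l \<le> 0)"

lemma order_continuous_norm_dual_iff:
  "order_continuous_norm TYPE('a::banach_lattice \<Rightarrow>\<^sub>L real) \<longleftrightarrow>
    (\<forall>D :: ('a \<Rightarrow>\<^sub>L real) set. D \<noteq> {} \<and> decreases_to_zero D \<longrightarrow>
      (\<forall>e>0. \<exists>d\<in>D. \<forall>f\<in>D. f \<le> d \<longrightarrow> norm f < e))"
  unfolding order_continuous_norm_def decreases_to_zero_def by (rule refl)

text \<open>The pointwise infimum over \<open>D\<close> is additive on the positive cone, so it
  extends to a functional that is a lower bound of \<open>D\<close> and is therefore at most 0.
  Order convergence to 0 in the dual thus gives pointwise convergence on positive vectors.\<close>

lemma directed_infimum_pointwise: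
  fixes D :: "('a::banach_lattice \<Rightarrow>\<^sub>L real) set"
  assumes "decreases_to_zero D" "d0 \<in> D"
    and "0 \<le> u" "0 < \<epsilon>"
  obtains d where "d \<in> D" "d \<le> d0" "d u < \<epsilon>"
proof -
  have dir: "\<exists>h\<in>D. h \<le> f \<and> h \<le> g" if "f \<in> D" "g \<in> D" for f g
    using assms(1) that by (simp add: decreases_to_zero_def)
  have pos: "0 \<le> f" if "f \<in> D" for f
    using assms(1) that by (simp add: decreases_to_zero_def)
  have inf0: "l \<le> 0" if "\<And>f. f \<in> D \<Longrightarrow> l \<le> f" for l
    using assms(1) that by (simp add: decreases_to_zero_def)
  define p where "p x = (INF f\<in>D. blinfun_apply f x)" for x
  have ne: "D \<noteq> {}" using assms(2) by auto
  have bdd: "bdd_below ((\<lambda>f. blinfun_apply f x) ` D)" if "0 \<le> x" for x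
    using positive_functional_nonneg[OF pos that] by (intro bdd_belowI2)
  have nonneg: "0 \<le> p x" if "0 \<le> x" for x
    unfolding p_def using ne that pos by (intro cINF_greatest positive_functional_nonneg) auto
  have lower: "p x \<le> f x" if "0 \<le> x" "f \<in> D" for x f
    unfolding p_def using bdd that by (intro cINF_lower) auto
  have greatest: "c \<le> p x" if "\<And>f. f \<in> D \<Longrightarrow> c \<le> f x" for c x
    unfolding p_def using ne that by (intro cINF_greatest) auto
  have near: "\<exists>f\<in>D. f x < c" if "p x < c" for x c
    using greatest[of c x] that by (meson not_le)
  have le: "blinfun_apply f x \<le> g x" if "f \<le> g" "0 \<le> x" for f g :: "'a \<Rightarrow>\<^sub>L real" and x
    using that by (simp add: less_eq_blinfun_def)
  obtain P where P: "\<And>x. 0 \<le> x \<Longrightarrow> blinfun_apply P x = p x"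
  proof (rule positive_cone_extension[of p "norm d0"])
    show "0 \<le> p x" if "0 \<le> x" for x
      using nonneg that .
    show "p (x + y) = p x + p y" if xy: "0 \<le> x" "0 \<le> y" for x y
    proof (rule antisym)
      show "p x + p y \<le> p (x + y)"
        using lower xy by (intro greatest) (simp add: blinfun.add_right add_mono)
      show "p (x + y) \<le> p x + p y"
      proof (rule field_le_epsilon)
        fix e :: real assume "0 < e"
        obtain f where f: "f \<in> D" "f x < p x + e / 2" using near[of x "p x + e / 2"] \<open>0 < e\<close> by auto
        obtain g where g: "g \<in> D" "g y < p y + e / 2" using near[of y "p y + e / 2"] \<open>0 < e\<close> by auto
        \<comment> \<open>Directedness enters here: one \<open>h\<close> serves for x and y
          simultaneously.\<close>
        obtain h where h: "h \<in> D" "h \<le> f" "h \<le> g" using dir f g by blast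
        have "p (x + y) \<le> h x + h y" using lower[of "x + y" h] xy h by (simp add: blinfun.add_right)
        also have "\<dots> \<le> f x + g y" using h xy by (intro add_mono le)
        finally show "p (x + y) \<le> p x + p y + e" using f g by simp
      qed
    qed
    show "p (c *\<^sub>R x) \<le> c * p x" if "0 < c" "0 \<le> x" for c x
    proof -
      have "p (c *\<^sub>R x) / c \<le> p x"
      proof (rule greatest)
        fix f assume "f \<in> D"
        then show "p (c *\<^sub>R x) / c \<le> f x"
          using lower[of "c *\<^sub>R x" f] that by (simp add: blinfun.scaleR_right scaleR_nonneg_nonneg field_simps)
      qed
      then show ?thesis using that by (simp add: field_simps)
    qed
    show "p x \<le> norm d0 * norm x" if "0 \<le> x" for x
      using lower[OF that assms(2)] functional_le_norm order_trans by blast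
  qed blast
  have "P \<le> 0" using lower P by (intro inf0) (simp add: less_eq_blinfun_def)
  then have "p u \<le> 0" using P \<open>0 \<le> u\<close> by (simp add: less_eq_blinfun_def blinfun.zero_left)
  then obtain f where f: "f \<in> D" "f u < \<epsilon>" using near[of u \<epsilon>] \<open>0 < \<epsilon>\<close> by auto
  \<comment> \<open>Going down once more by directedness places the functional below
    \<open>d0\<close> without increasing its value at \<open>u\<close>.\<close>
  obtain h where "h \<in> D" "h \<le> f" "h \<le> d0" using dir f assms(2) by blast
  then show ?thesis using that f le[of h f u] \<open>0 \<le> u\<close> by fastforce
qed

text \<open>\<open>\<psi>\<close> is the restriction of \<open>\<phi>\<close> to the band generated by \<open>v\<close>.\<close>

lemma band_restriction:
  fixes \<phi> :: "'a::banach_lattice \<Rightarrow>\<^sub>L real"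
  assumes "0 \<le> \<phi>" "0 \<le> v"
  obtains \<psi> where "0 \<le> \<psi>" "\<psi> \<le> \<phi>" "\<psi> v = \<phi> v" "\<And>x. inf x v = 0 \<Longrightarrow> \<psi> x = 0"
proof -
  \<comment> \<open>The elements inf x (t v) approximate x from the ideal generated by
    \<open>v\<close>. Taking the supremum of the values of \<phi> requires no band projection in the
    lattice itself.\<close>
  define p where "p x = (SUP t\<in>{0..}. \<phi> (inf x (t *\<^sub>R v)))" for x
  have bdd: "bdd_above ((\<lambda>t. \<phi> (inf x (t *\<^sub>R v))) ` {0..})" for x
    using positive_functional_mono[OF assms(1), of "inf x _" x] by (intro bdd_aboveI2) auto
  have upper: "\<phi> (inf x (t *\<^sub>R v)) \<le> p x" if "0 \<le> t" for x t
    unfolding p_def using bdd that by (intro cSUP_upper) auto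
  have least: "p x \<le> c" if "\<And>t. 0 \<le> t \<Longrightarrow> \<phi> (inf x (t *\<^sub>R v)) \<le> c" for x c
    unfolding p_def using that by (intro cSUP_least) auto
  have near: "\<exists>t\<ge>0. c < \<phi> (inf x (t *\<^sub>R v))" if "c < p x" for x c
    using least[of x c] that by (meson not_le)
  have le: "p x \<le> \<phi> x" for x
    using assms by (intro least positive_functional_mono) auto
  have nonneg: "0 \<le> p x" if "0 \<le> x" for x
    using upper[of 0 x] that by (simp add: inf.absorb2 blinfun.zero_right)
  obtain \<psi> where \<psi>: "\<And>x. 0 \<le> x \<Longrightarrow> blinfun_apply \<psi> x = p x"
  proof (rule positive_cone_extension[of p "norm \<phi>"])
    show "0 \<le> p x" if "0 \<le> x" for x using nonneg that .
    show "p (x + y) = p x + p y" if xy: "0 \<le> x" "0 \<le> y" for x y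
    proof (rule antisym)
      show "p (x + y) \<le> p x + p y"
      proof (rule least)
        fix t :: real assume t: "0 \<le> t"
        have "inf (x + y) (t *\<^sub>R v) \<le> inf x (t *\<^sub>R v) + inf y (t *\<^sub>R v)"
          using inf_add_le[of "t *\<^sub>R v" x y] xy t assms(2) by (simp add: inf.commute scaleR_nonneg_nonneg)
        then have "\<phi> (inf (x + y) (t *\<^sub>R v)) \<le> \<phi> (inf x (t *\<^sub>R v)) + \<phi> (inf y (t *\<^sub>R v))"
          using positive_functional_mono[OF assms(1)] by (simp flip: blinfun.add_right)
        also have "\<dots> \<le> p x + p y" using t upper by (intro add_mono)
        finally show "\<phi> (inf (x + y) (t *\<^sub>R v)) \<le> p x + p y" .
      qed
      show "p x + p y \<le> p (x + y)"
      proof (rule field_le_epsilon)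
        fix e :: real assume "0 < e"
        obtain s where s: "0 \<le> s" "p x - e / 2 < \<phi> (inf x (s *\<^sub>R v))"
          using near[of "p x - e / 2" x] \<open>0 < e\<close> by auto
        obtain t where t: "0 \<le> t" "p y - e / 2 < \<phi> (inf y (t *\<^sub>R v))"
          using near[of "p y - e / 2" y] \<open>0 < e\<close> by auto
        \<comment> \<open>Adding the parameters lets the near-optimal s for x and t for y be used
          together for x + y.\<close>
        have "inf x (s *\<^sub>R v) + inf y (t *\<^sub>R v) \<le> inf (x + y) ((s + t) *\<^sub>R v)"
          by (simp add: scaleR_add_left add_mono)
        then have "\<phi> (inf x (s *\<^sub>R v)) + \<phi> (inf y (t *\<^sub>R v)) \<le> \<phi> (inf (x + y) ((s + t) *\<^sub>R v))"
          using positive_functional_mono[OF assms(1)] by (simp flip: blinfun.add_right)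
        also have "\<dots> \<le> p (x + y)" using s t by (intro upper) auto
        finally show "p x + p y \<le> p (x + y) + e" using s t by simp
      qed
    qed
    show "p (c *\<^sub>R x) \<le> c * p x" if c: "0 < c" "0 \<le> x" for c x
    proof (rule least)
      fix t :: real assume t: "0 \<le> t"
      have "inf (c *\<^sub>R x) (t *\<^sub>R v) = c *\<^sub>R inf x ((t / c) *\<^sub>R v)"
        using c by (subst inf_scaleR[symmetric]) auto
      then show "\<phi> (inf (c *\<^sub>R x) (t *\<^sub>R v)) \<le> c * p x"
        using c t upper[of "t / c" x] by (simp add: blinfun.scaleR_right)
    qed
    show "p x \<le> norm \<phi> * norm x" for x
      using le functional_le_norm order_trans by blast
  qed blast
  show ?thesis
  proof (rule that)
    show "0 \<le> \<psi>" using nonneg \<psi> by (simp add: less_eq_blinfun_def blinfun.zero_left)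
    show "\<psi> \<le> \<phi>" using le \<psi> by (simp add: less_eq_blinfun_def)
    show "\<psi> v = \<phi> v" using upper[of 1 v] le[of v] \<psi>[OF assms(2)] by simp
    fix x assume x: "inf x v = 0"
    then have "0 \<le> x" by (metis inf.cobounded1)
    have "p x \<le> 0" using inf_scaleR_eq_0[OF x] by (intro least) (simp add: blinfun.zero_right)
    then show "\<psi> x = 0" using \<psi> nonneg \<open>0 \<le> x\<close> by fastforce
  qed
qed


section \<open>Disjoint sequences from a dual norm that is not order continuous\<close>

lemma inf_pprt_pprt_uminus: "inf (pprt x) (pprt (- x)) = (0::'a::banach_lattice)"
proof -
  have "inf (pprt x) (pprt (- x)) = inf (pprt x + 0) (pprt x + - x)"
    using pprt_diff_pprt_uminus[of x] by (simp add: algebra_simps)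
  also have "\<dots> = pprt x + inf 0 (- x)" by (simp only: add_inf_distrib_left)
  also have "inf 0 (- x) = - pprt x" by (simp add: pprt_def neg_sup_eq_inf inf.commute)
  finally show ?thesis by simp
qed

text \<open>Put z = a - t b. Since A \<ge> 1/t and a \<ge> 0, b - A a is at most -z/t. So
  \<open>x\<close> lies below the positive part of z and \<open>y\<close> below a multiple of its
  negative part.\<close>

lemma disjoint_pprt:
  fixes a b x y :: "'a::banach_lattice"
  assumes "0 < t" "1 \<le> t * A" "0 \<le> a"
    and x: "0 \<le> x" "x \<le> pprt (a - t *\<^sub>R b)"
    and y: "0 \<le> y" "y \<le> pprt (b - A *\<^sub>R a)"
  shows "inf x y = 0"
proof (rule antisym)
  let ?z = "a - t *\<^sub>R b"
  have "(1 / t) *\<^sub>R a \<le> A *\<^sub>R a" using assms by (intro scaleR_right_mono) (auto simp: field_simps)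
  then have "b - A *\<^sub>R a \<le> (1 / t) *\<^sub>R (- ?z)" using \<open>0 < t\<close> by (simp add: algebra_simps)
  also have "\<dots> \<le> (1 / t) *\<^sub>R pprt (- ?z)"
    using \<open>0 < t\<close> by (intro scaleR_left_mono) (auto simp only: pprt_def sup_ge1 zero_le_divide_1_iff)
  finally have "pprt (b - A *\<^sub>R a) \<le> (1 / t) *\<^sub>R pprt (- ?z)"
    using \<open>0 < t\<close> unfolding pprt_def by (intro sup_least scaleR_nonneg_nonneg) auto
  then have "inf x y \<le> inf (pprt ?z) ((1 / t) *\<^sub>R pprt (- ?z))"
    using x y by (intro inf_mono) auto
  also have "\<dots> = 0" using \<open>0 < t\<close> by (intro inf_scaleR_eq_0 inf_pprt_pprt_uminus) auto
  finally show "inf x y \<le> 0" .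
  show "0 \<le> inf x y" using x y by simp
qed

text \<open>Dependent choice alternates two moves: take \<open>u n\<close> almost norming for
  \<open>d n\<close>, then descend in \<open>D\<close> until the new functional is tiny on the
  accumulated vector, which dominates all earlier \<open>u k\<close>.\<close>

lemma almost_biorthogonal_sequence:
  fixes D :: "('a::banach_lattice \<Rightarrow>\<^sub>L real) set" and a :: "nat \<Rightarrow> real"
  assumes "decreases_to_zero D" "d0 \<in> D"
    and norm_ge: "\<forall>f\<in>D. r < norm f"
    and "0 \<le> r" and a: "\<forall>n. 0 < a n"
  obtains d :: "nat \<Rightarrow> 'a \<Rightarrow>\<^sub>L real" and u s :: "nat \<Rightarrow> 'a"
  where "\<And>n. 0 \<le> d n" "\<And>n. d (Suc n) \<le> d n" "d 0 \<le> d0"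
    and "\<And>n. 0 \<le> u n" "\<And>n. norm (u n) \<le> 1" "\<And>n. r < d n (u n)"
    and "\<And>n. 0 \<le> s n" "\<And>k n. k < n \<Longrightarrow> u k \<le> s n" "\<And>n. d n (s n) < a n"
proof -
  have pos: "0 \<le> f" if "f \<in> D" for f
    using assms(1) that by (simp add: decreases_to_zero_def)
  define P where "P n x \<longleftrightarrow> fst x \<in> D \<and> fst x \<le> d0 \<and> 0 \<le> snd x \<and> fst x (snd x) < a n" 
    for n and x :: "('a \<Rightarrow>\<^sub>L real) \<times> 'a"
  \<comment> \<open>A state is a pair (d, s). The vector \<open>u n\<close> is not stored but
    recovered as the increment of s.\<close>
  define Q where "Q x y \<longleftrightarrow> fst y \<le> fst x \<and> 0 \<le> snd y - snd x \<and> norm (snd y - snd x) \<le> 1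
      \<and> r < fst x (snd y - snd x)" for x y :: "('a \<Rightarrow>\<^sub>L real) \<times> 'a"
  have "\<exists>f. \<forall>n. P n (f n) \<and> Q (f n) (f (Suc n))"
  proof (rule dependent_nat_choice)
    show "\<exists>x. P 0 x"
      using assms(2) a by (intro exI[of _ "(d0, 0)"]) (simp add: P_def blinfun.zero_right)
    fix x :: "('a \<Rightarrow>\<^sub>L real) \<times> 'a" and n
    assume "P n x"
    then have x: "fst x \<in> D" "fst x \<le> d0" "0 \<le> snd x" by (auto simp: P_def)
    obtain u where u: "0 \<le> u" "norm u \<le> 1" "r < fst x u"
      using positive_functional_norm_attain[OF pos[OF x(1)] bspec[OF norm_ge x(1)] \<open>0 \<le> r\<close>] by blast
    obtain d where d: "d \<in> D" "d \<le> fst x" "d (snd x + u) < a (Suc n)"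
      using directed_infimum_pointwise[OF assms(1) x(1) add_nonneg_nonneg[OF x(3) u(1)] spec[OF a]] by blast
    show "\<exists>y. P (Suc n) y \<and> Q x y"
      using x u d by (intro exI[of _ "(d, snd x + u)"]) (auto simp: P_def Q_def intro: order_trans)
  qed
  then obtain f where f: "\<And>n. P n (f n)" "\<And>n. Q (f n) (f (Suc n))" by blast
  define d s where "d n = fst (f n)" and "s n = snd (f n)" for n
  have d: "d n \<in> D" "d n \<le> d0" "0 \<le> s n" "d n (s n) < a n" for n
    using f(1)[of n] by (simp_all add: P_def d_def s_def)
  have u: "d (Suc n) \<le> d n" "0 \<le> s (Suc n) - s n" "norm (s (Suc n) - s n) \<le> 1"
    "r < d n (s (Suc n) - s n)" for n
    using f(2)[of n] unfolding Q_def d_def s_def by blast+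
  have le: "s (Suc k) - s k \<le> s n" if "k < n" for k n
  proof -
    have "s (Suc k) \<le> s n" using u(2) that by (rule lift_Suc_mono_le[OF iffD1[OF diff_ge_0_iff_ge] Suc_leI])
    with _ show ?thesis by (rule order_trans) (use d(3) in simp)
  qed
  show ?thesis
    by (rule that[of d "\<lambda>n. s (Suc n) - s n" s]) (fact pos[OF d(1)] d u le)+
qed

text \<open>The sum of the weighted vectors converges absolutely, and positivity makes it dominate
  each term. Thus one vector controls all later \<open>u n\<close> at once, at the price of the
  factors 2^-n.\<close>

lemma geometric_majorant:
  fixes u :: "nat \<Rightarrow> 'a::banach_lattice"
  assumes "\<And>n. 0 \<le> u n" "\<And>n. norm (u n) \<le> 1"
  obtains w where "norm w \<le> 2" "\<And>n. (1/2) ^ n *\<^sub>R u n \<le> w"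
proof -
  let ?g = "\<lambda>n. (1/2) ^ n *\<^sub>R u n"
  have le: "norm (?g n) \<le> (1/2) ^ n" for n using assms(2)[of n] by (simp add: mult_left_le)
  have sg: "summable (\<lambda>n. (1/2::real) ^ n)" by (simp add: summable_geometric)
  have summable: "summable ?g" using le by (intro summable_comparison_test'[OF sg]) auto
  show ?thesis
  proof (rule that[of "suminf ?g"])
    have "norm (suminf ?g) \<le> (\<Sum>n. (1/2) ^ n)" using le sg by (rule norm_suminf_le)
    then show "norm (suminf ?g) \<le> 2" by (simp add: suminf_geometric)
    fix n
    have "?g n \<le> (\<Sum>k<N. ?g k)" if "n < N" for N
      using that assms(1) sum_mono2[of "{..<N}" "{n}" ?g] by (auto simp: scaleR_nonneg_nonneg)
    then show "?g n \<le> suminf ?g"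
      by (intro lim_mono_lattice[OF summable_LIMSEQ[OF summable]] eventually_sequentiallyI[of "Suc n"]) auto
  qed
qed

text \<open>The differences of consecutive \<open>d n\<close> are positive, telescope below
  \<open>d0\<close>, and are large on \<open>u n\<close>. Shrinking the \<open>u n\<close> to
  disjoint \<open>v n\<close> and restricting each difference to the band of its \<open>v n\<close>
  turns smallness off the diagonal into exact zeros.\<close>

lemma biorthogonal_sequence:
  fixes D :: "('a::banach_lattice \<Rightarrow>\<^sub>L real) set"
  assumes "decreases_to_zero D" "d0 \<in> D"
    and norm_ge: "\<forall>f\<in>D. r < norm f" and "0 < r"
  obtains \<psi> :: "nat \<Rightarrow> 'a \<Rightarrow>\<^sub>L real" and v :: "nat \<Rightarrow> 'a"
  where "\<And>n. 0 \<le> \<psi> n" "\<And>N x. 0 \<le> x \<Longrightarrow> (\<Sum>n<N. \<psi> n x) \<le> d0 x"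
    and "\<And>n. norm (v n) \<le> 1" "\<And>n. r / 4 \<le> \<psi> n (v n)" "\<And>n m. n \<noteq> m \<Longrightarrow> \<psi> n (v m) = 0"
proof -
  (* In v n = (u n - A n s n - c 2^-n w)^+ the products A n * (c 2^-m 2^-n) \<ge> 1 for m < n make the
     v n disjoint, while d n (s n) < a n and c norm w norm d0 \<le> r / 4 keep d n (v n) large. *)
  define c where "c = min 1 (r / (8 * (1 + norm d0)))"
  have "0 < 1 + norm d0" by (simp add: add_pos_nonneg)
  then have c: "0 < c" "c \<le> 1" using \<open>0 < r\<close> by (auto simp: c_def)
  have "c * (8 * (1 + norm d0)) \<le> r / (8 * (1 + norm d0)) * (8 * (1 + norm d0))"
    using \<open>0 < 1 + norm d0\<close> by (intro mult_right_mono) (auto simp: c_def)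
  then have "c * (8 * (1 + norm d0)) \<le> r" using \<open>0 < 1 + norm d0\<close> by simp
  then have c_small: "c * (2 * norm d0) \<le> r / 4" using c by (simp add: algebra_simps)
  define A where "A n = 4 ^ n / c" for n :: nat
  have A: "0 < A n" "1 \<le> A n" for n
    using c one_le_power[of "4::real" n] by (auto simp: A_def field_simps intro: order_trans)
  \<comment> \<open>Chosen so that subtracting \<open>A n *\<^sub>R s n\<close> costs at most A n *
    a n = r/4.\<close>
  define a where "a n = r / 4 / A n" for n
  have a: "0 < a n" "a n \<le> r / 4" "A n * a n = r / 4" for n
    using A[of n] \<open>0 < r\<close> by (auto simp: a_def field_simps)
  have a_pos: "\<forall>n. 0 < a n" using a(1) by blast
  obtain d u s where d: "\<And>n. 0 \<le> d n" "\<And>n. d (Suc n) \<le> d n" "d 0 \<le> d0"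
    and u: "\<And>n. 0 \<le> u n" "\<And>n. norm (u n) \<le> 1" "\<And>n. r < blinfun_apply (d n) (u n)"
    and s: "\<And>n. 0 \<le> s n" "\<And>k n. k < n \<Longrightarrow> u k \<le> s n" "\<And>n. blinfun_apply (d n) (s n) < a n"
    by (rule almost_biorthogonal_sequence[OF assms(1,2) norm_ge less_imp_le[OF \<open>0 < r\<close>] a_pos])
      (rule that; assumption)
  obtain w where w: "norm w \<le> 2" "\<And>n. (1/2) ^ n *\<^sub>R u n \<le> w"
    by (rule geometric_majorant[of u, OF u(1,2)]) (rule that; assumption)
  have "0 \<le> w" using order_trans[OF u(1)[of 0]] w(2)[of 0] by simp
  have d_Suc: "d (Suc n) x \<le> d n x" if "0 \<le> x" for n x
    using d(2)[of n] that by (simp add: less_eq_blinfun_def)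
  have d_le: "d n x \<le> d0 x" if "0 \<le> x" for n x
    using d_Suc[OF that] d(3) that
    by (induction n) (auto simp: less_eq_blinfun_def intro: order_trans)
  have d_nonneg: "0 \<le> d n x" if "0 \<le> x" for n x
    using positive_functional_nonneg[OF d(1) that] .
  define \<phi> where "\<phi> n = d n - d (Suc n)" for n
  have \<phi>: "0 \<le> \<phi> n" for n
    using d_Suc by (simp add: \<phi>_def less_eq_blinfun_def blinfun.diff_left)
  have \<phi>_le: "\<phi> n x \<le> d n x" if "0 \<le> x" for n x
    using d_nonneg[OF that] by (simp add: \<phi>_def blinfun.diff_left)
  define z where "z n = u n - A n *\<^sub>R s n - (c * (1/2) ^ n) *\<^sub>R w" for n
  define v where "v n = pprt (z n)" for n
  have v: "0 \<le> v n" for n by (simp add: v_def)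
  have "v n \<le> u n" for n
  proof -
    have "0 \<le> A n *\<^sub>R s n + (c * (1/2) ^ n) *\<^sub>R w"
      using A[of n] s(1)[of n] c \<open>0 \<le> w\<close> by (intro add_nonneg_nonneg scaleR_nonneg_nonneg) auto
    from diff_left_mono[OF this, of "u n"] have "z n \<le> u n" by (simp add: z_def diff_diff_eq)
    then show ?thesis using u(1) by (simp add: v_def pprt_def)
  qed
  then have norm_v: "norm (v n) \<le> 1" for n
    using norm_mono[OF v, of n "u n"] u(2)[of n] by simp
  have disjoint: "inf (v m) (v n) = 0" if "m < n" for m n
  proof (rule disjoint_pprt)
    \<comment> \<open>This t makes t u n at most the multiple of \<open>w\<close> subtracted in
      \<open>z m\<close>, while A n u m is at most the term A n s n subtracted in
      \<open>z n\<close>. The factor 4^n in \<open>A n\<close> covers 2^m 2^n for m < n.\<close>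
    let ?t = "c * (1/2) ^ m * (1/2) ^ n"
    show "0 < ?t" using c by simp
    have "(2::real) ^ m \<le> 2 ^ n" using that by (intro power_increasing) auto
    then have "(2::real) ^ m * 2 ^ n \<le> 2 ^ n * 2 ^ n" by simp
    also have "\<dots> = 4 ^ n" by (simp flip: power_mult_distrib)
    finally have "(2::real) ^ m * 2 ^ n \<le> 4 ^ n" .
    then show "1 \<le> ?t * A n" using c by (simp add: A_def power_one_over field_simps)
    show "0 \<le> u m" "0 \<le> v m" "0 \<le> v n" using u v by auto
    have sn: "0 \<le> A k *\<^sub>R s k" "0 \<le> (c * (1/2) ^ k) *\<^sub>R w" for k
      using A[of k] s(1)[of k] c \<open>0 \<le> w\<close> by (auto intro!: scaleR_nonneg_nonneg)
    have "?t *\<^sub>R u n = (c * (1/2) ^ m) *\<^sub>R ((1/2) ^ n *\<^sub>R u n)" by simp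
    also have "\<dots> \<le> (c * (1/2) ^ m) *\<^sub>R w" using c w(2) by (intro scaleR_left_mono) auto
    finally have "?t *\<^sub>R u n \<le> A m *\<^sub>R s m + (c * (1/2) ^ m) *\<^sub>R w"
      using sn(1)[of m] by (intro add_increasing)
    then have "z m \<le> u m - ?t *\<^sub>R u n" unfolding z_def diff_diff_eq by (rule diff_left_mono)
    then show "v m \<le> pprt (u m - ?t *\<^sub>R u n)" unfolding v_def by (rule pprt_mono)
    have "A n *\<^sub>R u m \<le> A n *\<^sub>R s n"
      using s(2)[OF that] A[of n] by (intro scaleR_left_mono) auto
    then have "A n *\<^sub>R u m \<le> A n *\<^sub>R s n + (c * (1/2) ^ n) *\<^sub>R w"
      using sn(2)[of n] by (rule add_increasing2[rotated])
    then have "z n \<le> u n - A n *\<^sub>R u m" unfolding z_def diff_diff_eq by (rule diff_left_mono)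
    then show "v n \<le> pprt (u n - A n *\<^sub>R u m)" unfolding v_def by (rule pprt_mono)
  qed
  have big: "r / 4 \<le> \<phi> n (v n)" for n
  proof -
    \<comment> \<open>Budget: the value on \<open>u n\<close> exceeds r - r/4, and the two
      subtracted terms cost at most r/4 each, so r/4 remains.\<close>
    have "d (Suc n) (u n) \<le> d (Suc n) (s (Suc n))"
      using positive_functional_mono[OF d(1) s(2)] by simp
    also have "\<dots> \<le> r / 4" using s(3)[of "Suc n"] a(2)[of "Suc n"] by simp
    finally have 1: "3 / 4 * r \<le> \<phi> n (u n)"
      using u(3)[of n] by (simp add: \<phi>_def blinfun.diff_left)
    have "A n * \<phi> n (s n) \<le> A n * a n"
      using \<phi>_le[OF s(1), of n n] s(3)[of n] A[of n] by (intro mult_left_mono) auto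
    then have 2: "A n * \<phi> n (s n) \<le> r / 4" by (simp add: a)
    have "\<phi> n w \<le> d0 w" using \<phi>_le d_le \<open>0 \<le> w\<close> order_trans by blast
    also have "\<dots> \<le> norm d0 * norm w" by (rule functional_le_norm)
    also have "\<dots> \<le> 2 * norm d0" using w(1) mult_left_mono[of "norm w" 2 "norm d0"] by simp
    finally have "(c * (1/2) ^ n) * \<phi> n w \<le> c * (2 * norm d0)"
      using c positive_functional_nonneg[OF \<phi> \<open>0 \<le> w\<close>] by (intro mult_mono) (auto simp: mult_left_le power_le_one)
    then have 3: "(c * (1/2) ^ n) * \<phi> n w \<le> r / 4" using c_small by simp
    have "r / 4 \<le> \<phi> n (u n) - A n * \<phi> n (s n) - (c * (1/2) ^ n) * \<phi> n w" using 1 2 3 by linarith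
    also have "\<dots> = \<phi> n (z n)" by (simp add: z_def blinfun.diff_right blinfun.scaleR_right)
    also have "\<dots> \<le> \<phi> n (v n)"
      using positive_functional_mono[OF \<phi>] by (simp add: v_def pprt_def)
    finally show ?thesis .
  qed
  have "\<exists>\<psi>. 0 \<le> \<psi> \<and> \<psi> \<le> \<phi> n \<and> \<psi> (v n) = \<phi> n (v n) \<and> (\<forall>x. inf x (v n) = 0 \<longrightarrow> \<psi> x = 0)" for n
    using band_restriction[OF \<phi> v, of n n] by metis
  then obtain \<psi> where \<psi>: "\<And>n. 0 \<le> \<psi> n" "\<And>n. \<psi> n \<le> \<phi> n" "\<And>n. \<psi> n (v n) = \<phi> n (v n)"
    "\<And>n x. inf x (v n) = 0 \<Longrightarrow> blinfun_apply (\<psi> n) x = 0" by metis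
  show ?thesis
  proof (rule that[of \<psi> v])
    show "(\<Sum>n<N. \<psi> n x) \<le> d0 x" if "0 \<le> x" for N x
    proof -
      have "(\<Sum>n<N. \<psi> n x) \<le> (\<Sum>n<N. d n x - d (Suc n) x)"
        using \<psi>(2) that by (intro sum_mono) (simp add: less_eq_blinfun_def \<phi>_def blinfun.diff_left)
      also have "\<dots> = d 0 x - d N x" by (rule sum_lessThan_telescope')
      also have "\<dots> \<le> d0 x" using d_le[OF that, of 0] d_nonneg[OF that, of N] by simp
      finally show ?thesis .
    qed
    show "\<psi> n (v m) = 0" if "n \<noteq> m" for n m
      using that disjoint[of n m] disjoint[of m n] by (intro \<psi>(4)) (auto simp: neq_iff inf.commute)
  qed (use \<psi> norm_v big in auto)
qed

section \<open>The operator\<close>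

text \<open>The absolute values of the coefficients have sum at most norm d0 * norm x. This gives
  absolute convergence in norm and, since each \<open>y n\<close> lies in [0, b], the order
  bound.\<close>

lemma order_bounded_operator:
  fixes \<psi> :: "nat \<Rightarrow> 'e::banach_lattice \<Rightarrow>\<^sub>L real" and d0 :: "'e \<Rightarrow>\<^sub>L real" and y :: "nat \<Rightarrow> 'f::banach_lattice"
  assumes \<psi>: "\<And>n. 0 \<le> \<psi> n" "\<And>N x. 0 \<le> x \<Longrightarrow> (\<Sum>n<N. \<psi> n x) \<le> d0 x"
    and y: "\<And>n. 0 \<le> y n" "\<And>n. y n \<le> b"
  obtains T :: "'e \<Rightarrow>\<^sub>L 'f"
  where "\<And>x. (\<lambda>n. \<psi> n x *\<^sub>R y n) sums T x" "0 \<le> T" "\<And>x. \<bar>T x\<bar> \<le> (norm d0 * norm x) *\<^sub>R b"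
proof -
  have "0 \<le> b" using y order_trans by blast
  have abs_sum: "(\<Sum>n<N. \<bar>\<psi> n x\<bar>) \<le> norm d0 * norm x" for N x
  proof -
    have "(\<Sum>n<N. \<bar>\<psi> n x\<bar>) \<le> (\<Sum>n<N. \<psi> n \<bar>x\<bar>)"
      by (intro sum_mono positive_functional_abs_le \<psi>)
    also have "\<dots> \<le> d0 \<bar>x\<bar>" by (intro \<psi>) simp
    also have "\<dots> \<le> norm d0 * norm x" using functional_le_norm[of d0 "\<bar>x\<bar>"] by simp
    finally show ?thesis .
  qed
  have summable_abs: "summable (\<lambda>n. \<bar>\<psi> n x\<bar>)" for x
    using abs_sum[of x "Suc _"]
    by (intro bounded_imp_summable[where B = "norm d0 * norm x"]) (auto simp: lessThan_Suc_atMost)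
  have norm_le: "norm (\<psi> n x *\<^sub>R y n) \<le> \<bar>\<psi> n x\<bar> * norm b" for n x
    using norm_mono[OF y] by (simp add: mult_left_mono)
  have summable: "summable (\<lambda>n. \<psi> n x *\<^sub>R y n)" for x
    using norm_le by (intro summable_comparison_test'[OF summable_mult2[OF summable_abs]]) auto
  define S where "S x = (\<Sum>n. \<psi> n x *\<^sub>R y n)" for x
  have S: "(\<lambda>n. \<psi> n x *\<^sub>R y n) sums S x" for x
    unfolding S_def by (rule summable_sums[OF summable])
  have bound: "\<bar>S x\<bar> \<le> (norm d0 * norm x) *\<^sub>R b" for x
  proof -
    let ?K = "(norm d0 * norm x) *\<^sub>R b"
    have le: "\<bar>\<Sum>n<N. \<psi> n x *\<^sub>R y n\<bar> \<le> ?K" for N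
    proof -
      have "\<bar>c *\<^sub>R y n\<bar> \<le> \<bar>c\<bar> *\<^sub>R b" for c n
      proof -
        have "c *\<^sub>R y n \<le> \<bar>c\<bar> *\<^sub>R y n" "(- c) *\<^sub>R y n \<le> \<bar>c\<bar> *\<^sub>R y n"
          by (rule scaleR_right_mono[OF _ y(1)], simp)+
        moreover have "\<bar>c\<bar> *\<^sub>R y n \<le> \<bar>c\<bar> *\<^sub>R b" by (intro scaleR_left_mono y) simp
        ultimately show ?thesis by (intro abs_leI) (auto intro: order_trans)
      qed
      then have "\<bar>\<Sum>n<N. \<psi> n x *\<^sub>R y n\<bar> \<le> (\<Sum>n<N. \<bar>\<psi> n x\<bar> *\<^sub>R b)"
        by (intro order_trans[OF sum_abs] sum_mono)
      also have "\<dots> = (\<Sum>n<N. \<bar>\<psi> n x\<bar>) *\<^sub>R b" by (simp add: scaleR_sum_left)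
      also have "\<dots> \<le> ?K" using abs_sum \<open>0 \<le> b\<close> by (rule scaleR_right_mono)
      finally show ?thesis .
    qed
    \<comment> \<open>Order limits are available for lower bounds only, so the upper bound is taken
      as a lower bound of the negated series.\<close>
    have "- ?K \<le> (\<Sum>n<N. \<psi> n x *\<^sub>R y n)" "- ?K \<le> (\<Sum>n<N. - (\<psi> n x *\<^sub>R y n))" for N
      using le[of N] unfolding abs_le_iff by (auto simp: sum_negf minus_le_iff)
    then have "- ?K \<le> S x" "- ?K \<le> - S x"
      using S[of x] sums_minus[OF S[of x]] unfolding sums_def
      by (blast intro: lim_mono_lattice always_eventually)+
    then show ?thesis by (intro abs_leI) (auto simp: minus_le_iff)
  qed
  have "bounded_linear S"
  proof (rule bounded_linear_intro)
    fix x z :: 'e and c :: real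
    show "S (x + z) = S x + S z"
      using sums_add[OF S[of x] S[of z]] S[of "x + z"] sums_unique2
      by (fastforce simp: blinfun.add_right scaleR_add_left)
    show "S (c *\<^sub>R x) = c *\<^sub>R S x"
      using sums_scaleR_right[OF S[of x], of c] S[of "c *\<^sub>R x"] sums_unique2
      by (fastforce simp: blinfun.scaleR_right)
    have "norm (S x) \<le> norm ((norm d0 * norm x) *\<^sub>R b)"
      using norm_mono[OF abs_ge_zero bound[of x]] by simp
    then show "norm (S x) \<le> norm x * (norm d0 * norm b)" by (simp add: ac_simps)
  qed
  then have app: "blinfun_apply (Blinfun S) = S" by (rule bounded_linear_Blinfun_apply)
  show ?thesis
  proof (rule that[of "Blinfun S"])
    have "0 \<le> S x" if "0 \<le> x" for x
      using S[of x] unfolding sums_def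
      by (rule lim_mono_lattice)
        (intro always_eventually allI sum_nonneg scaleR_nonneg_nonneg positive_functional_nonneg \<psi>(1) y(1) that)
    then show "0 \<le> Blinfun S" by (simp add: less_eq_blinfun_def app blinfun.zero_left)
  qed (use S bound app in auto)
qed

text \<open>The order bound passes to the solid hull of the image of the ball, so disjoint sequences
  there are order bounded and hence weakly null.\<close>

lemma disjointly_weakly_compact_operatorI:
  fixes T :: "'e::banach_lattice \<Rightarrow>\<^sub>L 'f::banach_lattice"
  assumes "\<And>x. norm x \<le> 1 \<Longrightarrow> \<bar>T x\<bar> \<le> b"
  shows "disjointly_weakly_compact_operator T"
  unfolding disjointly_weakly_compact_operator_def disjointly_weakly_compact_def
proof (intro conjI allI impI)
  show "bounded (blinfun_apply T ` cball 0 1)"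
    by (intro bounded_linear_image blinfun.bounded_linear_right bounded_cball)
  fix x :: "nat \<Rightarrow> 'f"
  assume x: "range x \<subseteq> solid_hull (blinfun_apply T ` cball 0 1) \<and> disjoint_sequence x"
  have "\<bar>x n\<bar> \<le> b" for n
  proof -
    have "x n \<in> solid_hull (blinfun_apply T ` cball 0 1)" using x by blast
    then obtain a where "norm a \<le> 1" "\<bar>x n\<bar> \<le> \<bar>T a\<bar>" by (auto simp: solid_hull_def)
    then show ?thesis using assms order_trans by blast
  qed
  then show "weakly_convergent_to x 0" using x order_bounded_disjoint_weakly_null by blast
qed

section \<open>Translation of order intervals and the final contradiction\<close>

lemma weakly_Cauchy_diff_const:
  assumes "weakly_Cauchy (\<lambda>n. x n - a)"
  shows "weakly_Cauchy x"
  unfolding weakly_Cauchy_def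
proof
  fix f :: "'a \<Rightarrow>\<^sub>L real"
  have "Cauchy (\<lambda>n. f (x n - a))" using assms by (simp add: weakly_Cauchy_def)
  then show "Cauchy (\<lambda>n. f (x n))" by (simp add: Cauchy_def blinfun.diff_right dist_norm)
qed

theorem theorem3p9:
  assumes "\<forall>T :: 'e::banach_lattice \<Rightarrow>\<^sub>L 'f::banach_lattice.
             0 \<le> T \<and> disjointly_weakly_compact_operator T \<longrightarrow> weakly_precompact_operator T"
  shows "order_continuous_norm TYPE('e \<Rightarrow>\<^sub>L real) \<or>
         (\<forall>a b :: 'f. weakly_precompact {a..b})"
proof (rule disjCI)
  assume "\<not> (\<forall>a b :: 'f. weakly_precompact {a..b})"
  then obtain a b :: 'f where "\<not> weakly_precompact {a..b}" by blast
  then obtain x :: "nat \<Rightarrow> 'f" where x: "range x \<subseteq> {a..b}"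
      and not_Cauchy: "\<forall>r. strict_mono r \<longrightarrow> \<not> weakly_Cauchy (x \<circ> r)"
    by (auto simp: weakly_precompact_def bounded_Icc_lattice)
  \<comment> \<open>The shift makes the vectors positive, as needed for T \<ge> 0, and does not
    affect weak Cauchy subsequences.\<close>
  define y where "y n = x n - a" for n
  have y: "0 \<le> y n" "y n \<le> b - a" for n using subsetD[OF x rangeI, of n] by (simp_all add: y_def)
  show "order_continuous_norm TYPE('e \<Rightarrow>\<^sub>L real)"
  proof (rule ccontr)
    assume "\<not> order_continuous_norm TYPE('e \<Rightarrow>\<^sub>L real)"
    then obtain D :: "('e \<Rightarrow>\<^sub>L real) set" and e where "D \<noteq> {}" and D: "decreases_to_zero D"
      and "0 < e" and not_small: "\<not> (\<exists>d\<in>D. \<forall>f\<in>D. f \<le> d \<longrightarrow> norm f < e)"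
      unfolding order_continuous_norm_dual_iff not_all not_imp
      by (elim exE conjE) (rule that; assumption)
    from not_small have far: "\<forall>d\<in>D. \<exists>f\<in>D. f \<le> d \<and> e \<le> norm f"
      by (simp add: not_less)
    have pos: "0 \<le> f" if "f \<in> D" for f
      using D that by (simp add: decreases_to_zero_def)
    \<comment> \<open>Each d in \<open>D\<close> dominates some f in \<open>D\<close> of norm at
      least \<open>e\<close>. Testing f on a positive unit-ball vector passes the bound to d; the
      halving supplies the strict inequality needed for such a vector.\<close>
    have norm_ge: "\<forall>d\<in>D. e / 2 < norm d"
    proof (rule ballI, rule ccontr)
      fix d assume d: "d \<in> D"
      assume small: "\<not> e / 2 < norm d"
      obtain f where f: "f \<in> D" "f \<le> d" "e \<le> norm f" using far d by blast
      obtain u where u: "0 \<le> u" "norm u \<le> 1" "e / 2 < f u"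
        using positive_functional_norm_attain[OF pos[OF f(1)], of "e / 2"] f(3) \<open>0 < e\<close> by auto
      have "f u \<le> d u" using f(2) u(1) by (simp add: less_eq_blinfun_def)
      also have "\<dots> \<le> norm d * norm u" by (rule functional_le_norm)
      also have "\<dots> \<le> norm d" using u(2) by (simp add: mult_left_le)
      finally show False using u(3) small by simp
    qed
    obtain d0 where "d0 \<in> D" using \<open>D \<noteq> {}\<close> by blast
    obtain \<psi> :: "nat \<Rightarrow> 'e \<Rightarrow>\<^sub>L real" and v
      where \<psi>: "\<And>n. 0 \<le> \<psi> n" "\<And>N x. 0 \<le> x \<Longrightarrow> (\<Sum>n<N. \<psi> n x) \<le> d0 x"
        and v: "\<And>n. norm (v n) \<le> 1" "\<And>n. e / 2 / 4 \<le> \<psi> n (v n)" "\<And>n m. n \<noteq> m \<Longrightarrow> \<psi> n (v m) = 0"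
      by (rule biorthogonal_sequence[OF D \<open>d0 \<in> D\<close> norm_ge half_gt_zero[OF \<open>0 < e\<close>]])
        (rule that; assumption)
    obtain T :: "'e \<Rightarrow>\<^sub>L 'f" where T: "\<And>x. (\<lambda>n. \<psi> n x *\<^sub>R y n) sums T x" "0 \<le> T"
        "\<And>x. \<bar>T x\<bar> \<le> (norm d0 * norm x) *\<^sub>R (b - a)"
      by (rule order_bounded_operator[of \<psi> d0 y "b - a", OF \<psi> y]) (assumption | rule that; assumption)+
    have "0 \<le> b - a" using y order_trans by blast
    have "\<bar>T x\<bar> \<le> norm d0 *\<^sub>R (b - a)" if "norm x \<le> 1" for x
      using T(3)[of x] scaleR_right_mono[OF mult_left_le[OF that norm_ge_zero[of d0]] \<open>0 \<le> b - a\<close>]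
      by (rule order_trans)
    then have "disjointly_weakly_compact_operator T" by (rule disjointly_weakly_compact_operatorI)
    then have "weakly_precompact_operator T" using assms T(2) by blast
    \<comment> \<open>The normalisation gives \<psi> n (z n) = 1, so by biorthogonality the series
      for T (z n) is the single term \<open>y n\<close>. The lower bound e/8 on \<psi> n (v n) keeps
      \<open>z\<close> bounded.\<close>
    moreover define z where "z n = (1 / \<psi> n (v n)) *\<^sub>R v n" for n
    have pos_v: "0 < \<psi> n (v n)" for n using v(2)[of n] \<open>0 < e\<close> by linarith
    have "norm (z n) \<le> 8 / e" for n
    proof -
      have "norm (z n) = norm (v n) / \<psi> n (v n)" using pos_v[of n] by (simp add: z_def)
      also have "\<dots> \<le> 1 / (e / 2 / 4)" using v(1,2)[of n] \<open>0 < e\<close> by (intro frac_le) auto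
      finally show ?thesis by simp
    qed
    then have "bounded (range z)" by (intro boundedI) auto
    ultimately have "weakly_precompact (blinfun_apply T ` range z)"
      by (simp add: weakly_precompact_operator_def)
    moreover have Tz: "T (z n) = y n" for n
    proof -
      have "(\<lambda>m. \<psi> m (z n) *\<^sub>R y m) = (\<lambda>m. if m = n then y m else 0)"
        using v(3)[of _ n] pos_v[of n] by (auto simp: z_def blinfun.scaleR_right)
      then show ?thesis using T(1)[of "z n"] sums_single[of n y] sums_unique2 by fastforce
    qed
    ultimately obtain r where r: "strict_mono r" "weakly_Cauchy (y \<circ> r)"
      unfolding weakly_precompact_def by (metis (no_types, lifting) image_image image_cong subset_refl)
    then have "weakly_Cauchy (\<lambda>n. (x \<circ> r) n - a)" by (simp add: y_def comp_def)
    then have "weakly_Cauchy (x \<circ> r)" by (rule weakly_Cauchy_diff_const)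
    then show False using not_Cauchy r(1) by blast
  qed
qed

end
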